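(* Let $\Omega\subset\mathbb{R}$ be a symmetric (i.e. $\Omega=-\Omega$) finite union of bounded open intervals with $0\in\operatorname{int}\Omega$. For all sufficiently large positive integers $N$ set $$A_N(\Omega)=\left\{n\in\mathbb{Z}:\frac nN+\left(-\frac1N,\frac1N\right)\subset\Omega\right\}.$$ Then $$\mathcal{T}_{\mathbb{R}}(\Omega)=\lim_{N\to\infty}\frac1N\,\mathcal{T}_{\mathbb{Z}}(A_N(\Omega)).$$
   Context: A function $f:\mathbb{R}\to\mathbb{C}$ is positive definite if $\sum_{j,k=1}^m z_j\overline{z_k}f(x_j-x_k)\ge 0$ for all finite choices of $x_1,\dots,x_m\in\mathbb{R}$ and $z_1,\dots,z_m\in\mathbb{C}$. For an open bounded set $\Omega\subset\mathbb{R}$ with $\Omega=-\Omega$ and $0\in\Omega$, the Turán constant is $$\mathcal{T}_{\mathbb{R}}(\Omega)=\sup\left\{\int_{\mathbb{R}}f(x)\,dx: f\in C(\mathbb{R}),\ f \text{ positive definite},\ f(0)=1,\ \operatorname{supp} f\subset\Omega\right\},$$ where $\operatorname{supp} f$ is the closed support of $f$ (the integrals in question are automatically real). A complex sequence $(c_n)_{n\in\mathbb{Z}}$ is positive definite if $\sum_{j,k=1}^r z_j\overline{z_k}c_{m_j-m_k}\ge0$ for every finite set $\{m_1,\dots,m_r\}\subset\mathbb{Z}$ and all $z_1,\dots,z_r\in\mathbb{C}$. For a finite set $A\subset\mathbb{Z}$ with $A=-A$ and $0\in A$, the discrete Turán constant is $$\mathcal{T}_{\mathbb{Z}}(A)=\sup\left\{\sum_{n\in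 A}c_n:(c_n)_{n\in\mathbb{Z}}\text{ positive definite},\ c_0=1,\ c_n=0\text{ for }n\notin A\right\}$$ (the sums in question are automatically real). "Sufficiently large $N$" means large enough that $(-1/N,1/N)\subset\Omega$, so that $0\in A_N(\Omega)$. *)

theory Defs
  imports "HOL-Analysis.Analysis"
begin

text \<open>The set \<open>\<real>\<^sub>\<ge>\<^sub>0\<close> of complex numbers renders
  ``\<open>\<ge> 0\<close>'' for complex quantities: real and nonnegative.\<close>

definition positive_definite_fun :: "(real \<Rightarrow> complex) \<Rightarrow> bool" where
  "positive_definite_fun f \<longleftrightarrow>
     (\<forall>(m::nat) (x :: nat \<Rightarrow> real) (z :: nat \<Rightarrow> complex).
        (\<Sum>j = 1..m. \<Sum>k = 1..m. z j * cnj (z k) * f (x j - x k)) \<in> \<real>\<^sub>\<ge>\<^sub>0)"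

text \<open>In the discrete case the points form a finite set of integers, which also serves as the
  index set of the coefficients.\<close>

definition positive_definite_seq :: "(int \<Rightarrow> complex) \<Rightarrow> bool" where
  "positive_definite_seq c \<longleftrightarrow>
     (\<forall>(M :: int set) (z :: int \<Rightarrow> complex). finite M \<longrightarrow>
        (\<Sum>j\<in>M. \<Sum>k\<in>M. z j * cnj (z k) * c (j - k)) \<in> \<real>\<^sub>\<ge>\<^sub>0)"

text \<open>Both constants below are suprema in the type of reals. They are meaningful when the domain is
  bounded (resp. finite) and contains a neighbourhood of 0 (resp. contains 0): the
  competitors are then bounded in modulus by their value 1 at the origin, so the supremum is over a
  nonempty bounded set. The integrals and sums are real by positive definiteness, so \<open>Re\<close>
  is only a change of type.\<close>

definition turan_real :: "real set \<Rightarrow> real" where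
  "turan_real \<Omega> =
     Sup {Re (LINT x|lborel. f x) | f :: real \<Rightarrow> complex.
            continuous_on UNIV f \<and> positive_definite_fun f \<and> f 0 = 1 \<and>
            closure {x. f x \<noteq> 0} \<subseteq> \<Omega>}"

definition turan_int :: "int set \<Rightarrow> real" where
  "turan_int A =
     Sup {Re (\<Sum>n\<in>A. c n) | c :: int \<Rightarrow> complex.
            positive_definite_seq c \<and> c 0 = 1 \<and> (\<forall>n. n \<notin> A \<longrightarrow> c n = 0)}"

definition discretization :: "real set \<Rightarrow> nat \<Rightarrow> int set" where
  "discretization \<Omega> N =
     {n. (\<lambda>t. real_of_int n / real N + t) ` {- (1 / real N) <..< 1 / real N} \<subseteq> \<Omega>}"

end

theory Submission
  imports Defs
begin

text \<open>The two constants are compared by passing from functions to sequences and back.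

  From the line to the integers one samples. If \<open>f\<close> is a competitor for \<open>\<Omega>\<close>, then
  \<open>c\<^sub>n = f (n/N)\<close> is positive definite, and its support lies in the discretization of \<open>\<Omega>\<close> once
  \<open>1/N\<close> is smaller than the distance from the compact support of \<open>f\<close> to the complement of \<open>\<Omega>\<close>.
  The values \<open>1/N \<Sum> c\<^sub>n\<close> are Riemann sums of \<open>\<integral> f\<close>, so every \<open>y < \<integral> f\<close> is eventually below the
  normalised discrete constant (\<open>eventually_less_turan_int_discretization\<close>).

  From the integers to the line one interpolates with triangles. A competitor \<open>c\<close> for the
  discretization gives \<open>f x = \<Sum> c\<^sub>n \<Lambda> (x - n/N)\<close>, where \<open>\<Lambda>\<close> is the hat function of height \<open>1\<close>
  and half-width \<open>\<delta> < 1/N\<close>. The strict inequality is what keeps the closed support inside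
  the open set \<open>\<Omega>\<close>: the intervals of half-width \<open>1/N\<close> about the points of the discretization
  lie in \<open>\<Omega>\<close>, but their end points need not. Since \<open>\<integral> f = \<delta> \<Sum> c\<^sub>n\<close>, letting \<open>\<delta>\<close> tend to
  \<open>1/N\<close> gives an inequality for each single \<open>N\<close>
  whose discretization contains \<open>0\<close> (\<open>turan_int_discretization_le\<close>).

  The remaining point is that this \<open>f\<close> is positive definite (\<open>positive_definite_hat_extension\<close>).
  Formally, \<open>f\<close> is the convolution of a positive definite measure on the lattice with the
  autocorrelation of an interval. The proof replaces harmonic analysis by two elementary facts:
  the hat function is an integral of products of translated indicators, and a finitely supported
  sequence \<open>d\<close> whose Toeplitz sections \<open>\<Sum> d\<^sub>m\<^sub>-\<^sub>p\<close> over \<open>m, p < K\<close> are all nonnegative has a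
  nonnegative sum, because these sections grow linearly in \<open>K\<close> with that sum as slope.\<close>

section \<open>Positive definite sequences and functions\<close>

lemma positive_definite_fun_imp_seq:
  assumes "positive_definite_fun f"
  shows "positive_definite_seq (\<lambda>n. f (real_of_int n * h))"
  unfolding positive_definite_seq_def
proof (intro allI impI)
  fix M :: "int set" and z :: "int \<Rightarrow> complex"
  assume "finite M"
  then obtain e where e: "bij_betw e {1..card M} M"
    using ex_bij_betw_nat_finite_1 by blast
  have "(\<Sum>j\<in>M. \<Sum>k\<in>M. z j * cnj (z k) * f (real_of_int (j - k) * h)) =
        (\<Sum>j = 1..card M. \<Sum>k = 1..card M. z (e j) * cnj (z (e k)) *
           f (real_of_int (e j) * h - real_of_int (e k) * h))"
    by (simp add: sum.reindex_bij_betw[OF e, symmetric] algebra_simps)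
  also have "\<dots> \<in> \<real>\<^sub>\<ge>\<^sub>0"
    using assms[unfolded positive_definite_fun_def, rule_format,
      of "\<lambda>j. z (e j)" "\<lambda>j. real_of_int (e j) * h" "card M"] by simp
  finally show "(\<Sum>j\<in>M. \<Sum>k\<in>M. z j * cnj (z k) * f (real_of_int (j - k) * h)) \<in> \<real>\<^sub>\<ge>\<^sub>0" .
qed

lemma positive_definite_seq_Re_le:
  assumes "positive_definite_seq c"
  shows "Re (c n) \<le> Re (c 0)"
proof (cases "n = 0")
  case False
  have pd: "a * cnj a * c 0 + a * cnj b * c (- n) + (b * cnj a * c n + b * cnj b * c 0) \<in> \<real>\<^sub>\<ge>\<^sub>0"
    for a b
    using assms[unfolded positive_definite_seq_def, rule_format,
      of "{0, n}" "\<lambda>j. if j = 0 then a else b"] False by simp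
  \<comment> \<open>The coefficients \<open>(1, -1)\<close> only bound the sum of \<open>c n\<close> and \<open>c (- n)\<close>; the
    coefficients \<open>(1, \<i>)\<close> are then used to see that the two real parts agree.\<close>
  have "Re (c n) + Re (c (- n)) \<le> 2 * Re (c 0)"
    using pd[of 1 "- 1"] by (simp add: complex_nonneg_Reals_iff)
  moreover have "Im (c 0) = 0"
    using pd[of 1 0] by (simp add: complex_nonneg_Reals_iff)
  then have "Re (c n) = Re (c (- n))"
    using pd[of 1 \<i>] by (simp add: complex_nonneg_Reals_iff)
  ultimately show ?thesis by simp
qed simp

text \<open>Apply the bound for sequences to the samples of \<open>f\<close> at the multiples of \<open>x\<close>.\<close>

lemma positive_definite_fun_Re_le:
  assumes "positive_definite_fun f"
  shows "Re (f x) \<le> Re (f 0)"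
  using positive_definite_seq_Re_le[OF positive_definite_fun_imp_seq[OF assms, of x], of 1] by simp

text \<open>This sequence shows that the discrete competitors exist; extended by a narrow hat, it also
  provides a competitor on the line.\<close>

lemma positive_definite_seq_delta: "positive_definite_seq (\<lambda>n. if n = 0 then 1 else 0)"
  unfolding positive_definite_seq_def
proof (intro allI impI)
  fix M :: "int set" and z :: "int \<Rightarrow> complex"
  assume M: "finite M"
  have "(\<Sum>k\<in>M. z j * cnj (z k) * (if j - k = 0 then 1 else 0)) = complex_of_real ((cmod (z j))\<^sup>2)"
    if "j \<in> M" for j
  proof -
    have "(\<Sum>k\<in>M. z j * cnj (z k) * (if j - k = 0 then 1 else 0)) =
      (\<Sum>k\<in>M. if j = k then z j * cnj (z k) else 0)"
      by (intro sum.cong) auto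
    also have "\<dots> = complex_of_real ((cmod (z j))\<^sup>2)"
      using that M unfolding complex_norm_square by simp
    finally show ?thesis .
  qed
  then have eq: "(\<Sum>j\<in>M. \<Sum>k\<in>M. z j * cnj (z k) * (if j - k = 0 then 1 else 0)) =
      complex_of_real (\<Sum>j\<in>M. (cmod (z j))\<^sup>2)"
    by simp
  show "(\<Sum>j\<in>M. \<Sum>k\<in>M. z j * cnj (z k) * (if j - k = 0 then 1 else 0)) \<in> \<real>\<^sub>\<ge>\<^sub>0"
    unfolding eq nonneg_Reals_of_real_iff by (simp add: sum_nonneg)
qed

section \<open>Sums of Toeplitz sections\<close>

text \<open>Enlarging a Toeplitz section adds one row, one column and one corner, which together meet each
  diagonal \<open>m - p = n\<close> with \<open>\<bar>n\<bar> \<le> K\<close> exactly once.\<close>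

lemma toeplitz_section_Suc:
  fixes d :: "int \<Rightarrow> complex"
  shows "(\<Sum>m<Suc K. \<Sum>p<Suc K. d (int m - int p)) =
         (\<Sum>m<K. \<Sum>p<K. d (int m - int p)) + (\<Sum>n = - int K..int K. d n)"
proof -
  have "(\<Sum>n = - int K..int K. d n) = (\<Sum>m<K. d (int m - int K)) + (\<Sum>p<K. d (int K - int p)) + d 0"
  proof -
    have "{- int K..int K} =
      ((\<lambda>m. int m - int K) ` {..<K} \<union> (\<lambda>p. int K - int p) ` {..<K}) \<union> {0}" (is "_ = (?A \<union> ?B) \<union> _")
    proof (intro equalityI subsetI)
      fix n assume n: "n \<in> {- int K..int K}"
      consider "n = 0" | "n < 0" | "n > 0" by linarith
      then show "n \<in> (?A \<union> ?B) \<union> {0}"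
      proof cases
        case 2
        then show ?thesis using n by (auto intro!: image_eqI[of _ _ "nat (n + int K)"])
      next
        case 3
        then show ?thesis using n by (auto intro!: image_eqI[of _ _ "nat (int K - n)"])
      qed auto
    qed auto
    then have "sum d {- int K..int K} = sum d ((?A \<union> ?B) \<union> {0})" by simp
    also have "\<dots> = sum d (?A \<union> ?B) + d 0" by (subst sum.union_disjoint) auto
    also have "sum d (?A \<union> ?B) = sum d ?A + sum d ?B" by (subst sum.union_disjoint) auto
    also have "sum d ?A = (\<Sum>m<K. d (int m - int K))" by (subst sum.reindex) (auto simp: inj_on_def)
    also have "sum d ?B = (\<Sum>m<K. d (int K - int m))" by (subst sum.reindex) (auto simp: inj_on_def)
    finally show ?thesis .
  qed
  then show ?thesis by (simp add: sum.distrib)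
qed

text \<open>Once \<open>K\<close> exceeds the support of \<open>d\<close>, each enlargement of the section adds the full sum \<open>S\<close>.
  So \<open>E\<^sub>L + j S\<close> is real and nonnegative for all \<open>j\<close>, which forces the same for \<open>S\<close>.\<close>

lemma nonneg_sum_of_toeplitz_sections:
  fixes d :: "int \<Rightarrow> complex"
  assumes "finite A" and supp: "\<And>n. n \<notin> A \<Longrightarrow> d n = 0"
    and pos: "\<And>K::nat. (\<Sum>m<K. \<Sum>p<K. d (int m - int p)) \<in> \<real>\<^sub>\<ge>\<^sub>0"
  shows "(\<Sum>n\<in>A. d n) \<in> \<real>\<^sub>\<ge>\<^sub>0"
proof -
  define E where "E K = (\<Sum>m<K. \<Sum>p<K. d (int m - int p))" for K :: nat
  define S where "S = (\<Sum>n\<in>A. d n)"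
  \<comment> \<open>Any bound for the moduli of the elements of \<open>A\<close> would do; this one also makes sense for empty \<open>A\<close>.\<close>
  define L where "L = nat (\<Sum>n\<in>A. \<bar>n\<bar>)"
  have L: "A \<subseteq> {- int K..int K}" if "L \<le> K" for K
  proof
    fix n assume "n \<in> A"
    then have "\<bar>n\<bar> \<le> (\<Sum>n\<in>A. \<bar>n\<bar>)" using assms(1) by (intro member_le_sum) auto
    then show "n \<in> {- int K..int K}" using that unfolding L_def by auto
  qed
  have step: "E (Suc K) = E K + S" if "L \<le> K" for K
  proof -
    have "(\<Sum>n = - int K..int K. d n) = S"
      unfolding S_def using L[OF that] supp by (intro sum.mono_neutral_right) auto
    then show ?thesis unfolding E_def toeplitz_section_Suc by simp
  qed
  have E: "E (L + j) = E L + of_nat j * S" for j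
    by (induction j) (simp_all add: step algebra_simps)
  have nn: "E L + of_nat j * S \<in> \<real>\<^sub>\<ge>\<^sub>0" for j
    using pos[of "L + j"] E[of j] unfolding E_def by simp
  have "Im S = 0"
    using nn[of 0] nn[of 1] by (simp add: complex_nonneg_Reals_iff)
  moreover have "Re S \<ge> 0"
  proof (rule ccontr)
    assume "\<not> Re S \<ge> 0"
    then have "- Re S > 0" by simp
    then obtain j where "Re (E L) < real j * (- Re S)" using reals_Archimedean3 by blast
    then show False using nn[of j] by (simp add: complex_nonneg_Reals_iff)
  qed
  ultimately show ?thesis by (simp add: S_def complex_nonneg_Reals_iff)
qed

section \<open>Hat functions\<close>

definition hat :: "real \<Rightarrow> real \<Rightarrow> real" where
  "hat \<delta> x = max 0 (1 - \<bar>x\<bar> / \<delta>)"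

lemma hat_0 [simp]: "hat \<delta> 0 = 1"
  by (simp add: hat_def)

lemma hat_eq_0: "0 < \<delta> \<Longrightarrow> \<delta> \<le> \<bar>x\<bar> \<Longrightarrow> hat \<delta> x = 0"
  by (simp add: hat_def field_simps)

lemma continuous_on_hat [continuous_intros]:
  assumes "\<delta> > 0" "continuous_on S f"
  shows "continuous_on S (\<lambda>x. hat \<delta> (f x))"
  unfolding hat_def using assms by (auto intro!: continuous_intros)

lemma has_bochner_integral_hat:
  assumes "\<delta> > 0"
  shows "has_bochner_integral lborel (\<lambda>x. hat \<delta> (x - a)) \<delta>"
proof -
  have "has_bochner_integral lborel (\<lambda>x. (1 - x / \<delta>) * indicator {0..\<delta>} x)
      ((\<delta> - \<delta>\<^sup>2 / (2 * \<delta>)) - (0 - 0\<^sup>2 / (2 * \<delta>)))"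
    using assms
    by (intro has_bochner_integral_FTC_Icc_nonneg) (auto intro!: derivative_eq_intros continuous_intros simp: field_simps)
  then have half: "has_bochner_integral lborel (\<lambda>x. (1 - x / \<delta>) * indicator {0..\<delta>} x) (\<delta> / 2)"
    using assms by (simp add: power2_eq_square field_simps)
  have r: "has_bochner_integral lborel (\<lambda>x. (1 - (x - a) / \<delta>) * indicator {0..\<delta>} (x - a)) (\<delta> / 2)"
    using lborel_has_bochner_integral_real_affine_iff[of 1 "\<lambda>x. (1 - x / \<delta>) * indicator {0..\<delta>} x" "\<delta> / 2" "- a"] half by simp
  have l: "has_bochner_integral lborel (\<lambda>x. (1 - (a - x) / \<delta>) * indicator {0..\<delta>} (a - x)) (\<delta> / 2)"
    using lborel_has_bochner_integral_real_affine_iff[of "-1" "\<lambda>x. (1 - x / \<delta>) * indicator {0..\<delta>} x" "\<delta> / 2" a] half by simp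
  have sum: "has_bochner_integral lborel (\<lambda>x. (1 - (x - a) / \<delta>) * indicator {0..\<delta>} (x - a) +
      (1 - (a - x) / \<delta>) * indicator {0..\<delta>} (a - x)) \<delta>"
    using has_bochner_integral_add[OF r l] by simp
  show ?thesis
  proof (rule has_bochner_integral_cong_AE[THEN iffD1, OF _ _ _ sum])
    \<comment> \<open>At \<open>x = a\<close> both halves contribute, so equality holds only off this point.\<close>
    show "AE x in lborel. (1 - (x - a) / \<delta>) * indicator {0..\<delta>} (x - a) +
      (1 - (a - x) / \<delta>) * indicator {0..\<delta>} (a - x) = hat \<delta> (x - a)"
      using AE_lborel_singleton[of a]
    proof eventually_elim
      case (elim x)
      then show ?case using assms
        by (auto simp: hat_def indicator_def field_simps max_def abs_if)
    qed
    show "(\<lambda>x. hat \<delta> (x - a)) \<in> borel_measurable lborel"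
      unfolding hat_def by measurable
  qed (use sum in \<open>auto simp: has_bochner_integral_iff\<close>)
qed

text \<open>The hat function as an autocorrelation: up to the factor \<open>\<delta>\<close> it is the length of the overlap of
  two intervals of length \<open>\<delta>\<close>. This is the source of its positive definiteness.\<close>

lemma has_bochner_integral_interval_overlap:
  assumes "\<delta> > 0"
  shows "has_bochner_integral lborel
    (\<lambda>t. indicator {a..a + \<delta>} t * indicator {b..b + \<delta>} t) (\<delta> * hat \<delta> (a - b))"
proof -
  have eq: "(\<lambda>t. indicator {a..a + \<delta>} t * indicator {b..b + \<delta>} t :: real) =
      indicator {max a b..min a b + \<delta>}"
    by (auto simp: fun_eq_iff indicator_def)
  have "measure lborel {max a b..min a b + \<delta>} = \<delta> * hat \<delta> (a - b)"
    using assms by (auto simp: measure_def hat_def max_def min_def field_simps abs_if)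
  moreover have "has_bochner_integral lborel (indicator {max a b..min a b + \<delta>} :: real \<Rightarrow> real)
      (measure lborel {max a b..min a b + \<delta>})"
    by (intro has_bochner_integral_real_indicator emeasure_compact_finite) auto
  ultimately show ?thesis unfolding eq by simp
qed

section \<open>Extending a positive definite sequence to the line\<close>

text \<open>The convolution of \<open>\<Sum> c\<^sub>n\<close> times the unit mass at \<open>n h\<close> with the hat function.\<close>

definition hat_extension :: "real \<Rightarrow> real \<Rightarrow> int set \<Rightarrow> (int \<Rightarrow> complex) \<Rightarrow> real \<Rightarrow> complex" where
  "hat_extension h \<delta> A c x = (\<Sum>n\<in>A. c n * complex_of_real (hat \<delta> (x - real_of_int n * h)))"

lemma has_bochner_integral_imp_nonneg:
  fixes g :: "'a \<Rightarrow> complex"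
  assumes "has_bochner_integral M g I" and "\<And>t. g t \<in> \<real>\<^sub>\<ge>\<^sub>0"
  shows "I \<in> \<real>\<^sub>\<ge>\<^sub>0"
proof -
  have I: "integrable M g" "I = integral\<^sup>L M g"
    using assms(1) by (auto simp: has_bochner_integral_iff)
  have "Re I = (\<integral>t. Re (g t) \<partial>M)" "Im I = (\<integral>t. Im (g t) \<partial>M)"
    using I by simp_all
  moreover have "Im (g t) = 0" "Re (g t) \<ge> 0" for t
    using assms(2)[of t] by (auto simp: complex_nonneg_Reals_iff)
  ultimately show ?thesis
    by (simp add: complex_nonneg_Reals_iff)
qed

text \<open>For the quadratic form with points \<open>x\<^sub>j\<close> and coefficients \<open>z\<^sub>j\<close> put
  \<open>U\<^sub>m t = \<Sum> z\<^sub>j\<close>, summed over those \<open>j\<close> for which \<open>t\<close> lies in the interval of length \<open>\<delta>\<close> starting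
  at \<open>x\<^sub>j - m h\<close>. For fixed \<open>t\<close> the form \<open>\<Sum> c\<^sub>m\<^sub>-\<^sub>p U\<^sub>m t cnj (U\<^sub>p t)\<close> over \<open>m, p < K\<close> is nonnegative because \<open>c\<close> is
  positive definite. Integrating over \<open>t\<close> turns the products of indicators into hats, and the
  result is a Toeplitz section of \<open>d\<close>, where \<open>d\<^sub>n\<close> is the part of the quadratic form that comes
  from \<open>c\<^sub>n\<close>. The sum of all \<open>d\<^sub>n\<close> is the quadratic form itself.\<close>

lemma positive_definite_hat_extension:
  assumes c: "positive_definite_seq c" "\<And>n. n \<notin> A \<Longrightarrow> c n = 0" and A: "finite A" and \<delta>: "\<delta> > 0"
  shows "positive_definite_fun (hat_extension h \<delta> A c)"
  unfolding positive_definite_fun_def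
proof (intro allI)
  fix r :: nat and x :: "nat \<Rightarrow> real" and z :: "nat \<Rightarrow> complex"
  define d where "d n = c n * (\<Sum>j = 1..r. \<Sum>k = 1..r. z j * cnj (z k) *
      complex_of_real (hat \<delta> (x j - x k - real_of_int n * h)))" for n
  define U where "U m t = (\<Sum>j = 1..r. z j *
      complex_of_real (indicator {x j - real m * h..x j - real m * h + \<delta>} t))" for m :: nat and t
  have "(\<Sum>m<K. \<Sum>p<K. d (int m - int p)) \<in> \<real>\<^sub>\<ge>\<^sub>0" for K
  proof -
    have overlap: "has_bochner_integral lborel
        (\<lambda>t. c (int m - int p) * (U m t * cnj (U p t))) (of_real \<delta> * d (int m - int p))" for m p
    proof -
      have "has_bochner_integral lborel
        (\<lambda>t. c (int m - int p) * (\<Sum>j = 1..r. \<Sum>k = 1..r. z j * cnj (z k) * complex_of_real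
          (indicator {x j - real m * h..x j - real m * h + \<delta>} t *
           indicator {x k - real p * h..x k - real p * h + \<delta>} t)))
        (c (int m - int p) * (\<Sum>j = 1..r. \<Sum>k = 1..r. z j * cnj (z k) * complex_of_real
          (\<delta> * hat \<delta> ((x j - real m * h) - (x k - real p * h)))))"
        by (intro has_bochner_integral_mult_right has_bochner_integral_sum
            has_bochner_integral_of_real has_bochner_integral_interval_overlap \<delta>)
      moreover have "c (int m - int p) * (\<Sum>j = 1..r. \<Sum>k = 1..r. z j * cnj (z k) * complex_of_real
          (\<delta> * hat \<delta> ((x j - real m * h) - (x k - real p * h)))) = of_real \<delta> * d (int m - int p)"
        by (simp add: d_def sum_distrib_left algebra_simps)
      moreover have "U m t * cnj (U p t) = (\<Sum>j = 1..r. \<Sum>k = 1..r. z j * cnj (z k) * complex_of_real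
          (indicator {x j - real m * h..x j - real m * h + \<delta>} t *
           indicator {x k - real p * h..x k - real p * h + \<delta>} t))" for t
        by (simp add: U_def sum_product algebra_simps)
      ultimately show ?thesis by simp
    qed
    have "has_bochner_integral lborel
        (\<lambda>t. \<Sum>m<K. \<Sum>p<K. c (int m - int p) * (U m t * cnj (U p t)))
        (\<Sum>m<K. \<Sum>p<K. of_real \<delta> * d (int m - int p))"
      by (intro has_bochner_integral_sum overlap)
    moreover have "(\<Sum>m<K. \<Sum>p<K. c (int m - int p) * (U m t * cnj (U p t))) \<in> \<real>\<^sub>\<ge>\<^sub>0" for t
    proof -
      have "(\<Sum>m\<in>int ` {..<K}. \<Sum>p\<in>int ` {..<K}. U (nat m) t * cnj (U (nat p) t) * c (m - p)) \<in> \<real>\<^sub>\<ge>\<^sub>0"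
        using c(1)[unfolded positive_definite_seq_def, rule_format,
          of "int ` {..<K}" "\<lambda>m. U (nat m) t"] by simp
      then show ?thesis by (simp add: sum.reindex mult.commute)
    qed
    ultimately have "(\<Sum>m<K. \<Sum>p<K. of_real \<delta> * d (int m - int p)) \<in> \<real>\<^sub>\<ge>\<^sub>0"
      by (rule has_bochner_integral_imp_nonneg)
    then have "of_real \<delta> * (\<Sum>m<K. \<Sum>p<K. d (int m - int p)) \<in> \<real>\<^sub>\<ge>\<^sub>0"
      by (simp add: sum_distrib_left)
    then show ?thesis
      using \<delta> by (simp add: complex_nonneg_Reals_iff zero_le_mult_iff)
  qed
  then have "(\<Sum>n\<in>A. d n) \<in> \<real>\<^sub>\<ge>\<^sub>0"
    using A c(2) by (intro nonneg_sum_of_toeplitz_sections) (auto simp: d_def)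
  also have "(\<Sum>n\<in>A. d n) =
    (\<Sum>n\<in>A. \<Sum>j = 1..r. \<Sum>k = 1..r. z j * cnj (z k) *
      (c n * complex_of_real (hat \<delta> (x j - x k - real_of_int n * h))))"
    by (simp add: d_def sum_distrib_left algebra_simps)
  also have "\<dots> = (\<Sum>j = 1..r. \<Sum>n\<in>A. \<Sum>k = 1..r. z j * cnj (z k) *
      (c n * complex_of_real (hat \<delta> (x j - x k - real_of_int n * h))))"
    by (rule sum.swap)
  also have "\<dots> = (\<Sum>j = 1..r. \<Sum>k = 1..r. \<Sum>n\<in>A. z j * cnj (z k) *
      (c n * complex_of_real (hat \<delta> (x j - x k - real_of_int n * h))))"
    by (intro sum.cong refl sum.swap)
  also have "\<dots> = (\<Sum>j = 1..r. \<Sum>k = 1..r. z j * cnj (z k) * hat_extension h \<delta> A c (x j - x k))"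
    by (simp add: hat_extension_def sum_distrib_left)
  finally show "(\<Sum>j = 1..r. \<Sum>k = 1..r. z j * cnj (z k) * hat_extension h \<delta> A c (x j - x k)) \<in> \<real>\<^sub>\<ge>\<^sub>0" .
qed

lemma continuous_hat_extension: "\<delta> > 0 \<Longrightarrow> continuous_on UNIV (hat_extension h \<delta> A c)"
  unfolding hat_extension_def by (intro continuous_intros) auto

text \<open>The hats around the other lattice points \<open>n h\<close> do not reach \<open>0\<close>, as \<open>\<delta> \<le> h\<close>.\<close>

lemma hat_extension_at_0:
  assumes "finite A" "0 \<in> A" "0 < \<delta>" "\<delta> \<le> h"
  shows "hat_extension h \<delta> A c 0 = c 0"
proof -
  have "hat \<delta> (0 - real_of_int n * h) = 0" if "n \<noteq> 0" for n
  proof (rule hat_eq_0[OF assms(3)])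
    have "\<delta> \<le> 1 * h" using assms(4) by simp
    also have "\<dots> \<le> \<bar>real_of_int n\<bar> * h"
      using that assms by (intro mult_right_mono) auto
    also have "\<dots> = \<bar>0 - real_of_int n * h\<bar>" using assms by (simp add: abs_mult)
    finally show "\<delta> \<le> \<bar>0 - real_of_int n * h\<bar>" .
  qed
  then have "hat_extension h \<delta> A c 0 = (\<Sum>n\<in>{0}. c n * of_real (hat \<delta> (0 - real_of_int n * h)))"
    unfolding hat_extension_def using assms by (intro sum.mono_neutral_right) auto
  then show ?thesis by simp
qed

lemma closure_support_hat_extension:
  assumes "finite A" "\<delta> > 0"
  shows "closure {x. hat_extension h \<delta> A c x \<noteq> 0} \<subseteq>
    (\<Union>n\<in>A. {real_of_int n * h - \<delta>..real_of_int n * h + \<delta>})"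
proof (rule closure_minimal)
  show "{x. hat_extension h \<delta> A c x \<noteq> 0} \<subseteq>
    (\<Union>n\<in>A. {real_of_int n * h - \<delta>..real_of_int n * h + \<delta>})"
  proof
    fix x assume "x \<in> {x. hat_extension h \<delta> A c x \<noteq> 0}"
    then have "\<exists>n\<in>A. hat \<delta> (x - real_of_int n * h) \<noteq> 0"
      unfolding hat_extension_def by (auto intro: ccontr)
    then obtain n where "n \<in> A" "hat \<delta> (x - real_of_int n * h) \<noteq> 0" by blast
    moreover then have "\<bar>x - real_of_int n * h\<bar> < \<delta>"
      using hat_eq_0[OF assms(2)] by (meson not_less)
    ultimately show "x \<in> (\<Union>n\<in>A. {real_of_int n * h - \<delta>..real_of_int n * h + \<delta>})"
      by (intro UN_I[of n]) auto
  qed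
qed (use assms in \<open>auto intro: closed_UN\<close>)

lemma integral_hat_extension:
  assumes "\<delta> > 0"
  shows "(LINT x|lborel. hat_extension h \<delta> A c x) = of_real \<delta> * (\<Sum>n\<in>A. c n)"
proof -
  have "has_bochner_integral lborel (hat_extension h \<delta> A c) (\<Sum>n\<in>A. c n * of_real \<delta>)"
    unfolding hat_extension_def using assms
    by (intro has_bochner_integral_sum has_bochner_integral_mult_right
        has_bochner_integral_of_real has_bochner_integral_hat)
  then show ?thesis
    by (simp add: has_bochner_integral_iff sum_distrib_left mult.commute)
qed

section \<open>Sampling a continuous function of compact support\<close>

text \<open>The integrand is constant on each interval \<open>[n/N, (n+1)/N)\<close>, so the Riemann sum is literally
  an integral and its convergence can be left to dominated convergence.\<close>

lemma integral_step_function: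
  fixes f :: "real \<Rightarrow> complex"
  assumes "finite F" "N > 0" and supp: "\<And>n. f (real_of_int n / real N) \<noteq> 0 \<Longrightarrow> n \<in> F"
  shows "(LINT x|lborel. f (real_of_int \<lfloor>real N * x\<rfloor> / real N)) =
    of_real (1 / real N) * (\<Sum>n\<in>F. f (real_of_int n / real N))"
proof -
  let ?J = "\<lambda>n::int. {real_of_int n / real N..<(real_of_int n + 1) / real N}"
  have J: "x \<in> ?J n \<longleftrightarrow> \<lfloor>real N * x\<rfloor> = n" for x n
    using assms(2) by (auto simp: floor_eq_iff field_simps)
  have "f (real_of_int \<lfloor>real N * x\<rfloor> / real N) =
      (\<Sum>n\<in>F. f (real_of_int n / real N) * complex_of_real (indicator (?J n) x))" for x
  proof -
    have "(\<Sum>n\<in>F. f (real_of_int n / real N) * complex_of_real (indicator (?J n) x)) =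
      (\<Sum>n\<in>F. if \<lfloor>real N * x\<rfloor> = n then f (real_of_int n / real N) else 0)"
      unfolding indicator_def J by (intro sum.cong) auto
    also have "\<dots> = f (real_of_int \<lfloor>real N * x\<rfloor> / real N)"
      using assms(1) supp by auto
    finally show ?thesis by simp
  qed
  moreover have "has_bochner_integral lborel
      (\<lambda>x. \<Sum>n\<in>F. f (real_of_int n / real N) * complex_of_real (indicator (?J n) x))
      (\<Sum>n\<in>F. f (real_of_int n / real N) * complex_of_real (measure lborel (?J n)))"
    by (intro has_bochner_integral_sum has_bochner_integral_mult_right
        has_bochner_integral_of_real has_bochner_integral_real_indicator
        emeasure_bounded_finite) auto
  moreover have "measure lborel (?J n) = 1 / real N" for n
    using assms(2) by (simp add: measure_def field_simps)
  ultimately show ?thesis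
    by (simp add: has_bochner_integral_iff sum_distrib_left mult.commute)
qed

lemma floor_sample_tendsto: "(\<lambda>N. real_of_int \<lfloor>real N * x\<rfloor> / real N) \<longlonglongrightarrow> x"
proof (rule tendsto_sandwich)
  have floor: "real N * x - 1 \<le> real_of_int \<lfloor>real N * x\<rfloor>" for N
    by linarith
  show "\<forall>\<^sub>F N in sequentially. x - 1 / real N \<le> real_of_int \<lfloor>real N * x\<rfloor> / real N"
    using eventually_gt_at_top[of 0]
  proof eventually_elim
    case (elim N)
    then show ?case using divide_right_mono[OF floor[of N], of "real N"] by (simp add: diff_divide_distrib)
  qed
  show "\<forall>\<^sub>F N in sequentially. real_of_int \<lfloor>real N * x\<rfloor> / real N \<le> x"
    using eventually_gt_at_top[of 0]
  proof eventually_elim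
    case (elim N)
    then show ?case
      using divide_right_mono[OF of_int_floor_le[of "real N * x"], of "real N"] by simp
  qed
  show "(\<lambda>N. x - 1 / real N) \<longlonglongrightarrow> x"
    using tendsto_diff[OF tendsto_const[of x] lim_1_over_n] by simp
qed simp

lemma riemann_sum_tendsto:
  fixes f :: "real \<Rightarrow> complex"
  assumes cont: "continuous_on UNIV f" and R: "\<And>x. f x \<noteq> 0 \<Longrightarrow> \<bar>x\<bar> \<le> R"
    and F: "\<forall>\<^sub>F N in sequentially. finite (F N) \<and> (\<forall>n. f (real_of_int n / real N) \<noteq> 0 \<longrightarrow> n \<in> F N)"
  shows "(\<lambda>N. of_real (1 / real N) * (\<Sum>n\<in>F N. f (real_of_int n / real N)))
           \<longlonglongrightarrow> (LINT x|lborel. f x)"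
proof -
  have "bounded (f ` {-R..R})"
    using cont by (intro compact_imp_bounded compact_continuous_image)
      (auto intro: continuous_on_subset)
  then obtain B where B: "B > 0" "\<And>x. x \<in> {-R..R} \<Longrightarrow> norm (f x) \<le> B"
    by (auto simp: bounded_pos)
  have fB: "norm (f x) \<le> B" for x
  proof (cases "f x = 0")
    case False
    then show ?thesis using R[of x] B(2)[of x] by (auto simp: abs_le_iff)
  qed (use B in auto)
  let ?s = "\<lambda>N x. f (real_of_int \<lfloor>real N * x\<rfloor> / real N)"
  \<comment> \<open>The shift avoids \<open>N = 0\<close>, where division by zero makes the step function the constant
    \<open>f 0\<close>, in general not integrable.\<close>
  let ?s' = "\<lambda>N. ?s (Suc N)"
  have meas: "f \<in> borel_measurable borel"
    using cont by (rule borel_measurable_continuous_onI)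
  have "(\<lambda>N. LINT x|lborel. ?s' N x) \<longlonglongrightarrow> (LINT x|lborel. f x)"
  proof (rule integral_dominated_convergence)
    show "f \<in> borel_measurable lborel" using meas by simp
    show "?s' N \<in> borel_measurable lborel" for N using meas by measurable
    show "integrable lborel (\<lambda>x. B * indicator {-R-1..R+1} x)"
      by (intro integrable_mult_right integrable_real_indicator emeasure_bounded_finite) auto
    show "AE x in lborel. (\<lambda>N. ?s' N x) \<longlonglongrightarrow> f x"
    proof (rule AE_I2)
      fix x
      have "isCont f x" using cont by (simp add: continuous_on_eq_continuous_at)
      then have "(\<lambda>N. ?s N x) \<longlonglongrightarrow> f x"
        using floor_sample_tendsto by (rule isCont_tendsto_compose)
      then show "(\<lambda>N. ?s' N x) \<longlonglongrightarrow> f x" by (rule LIMSEQ_Suc)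
    qed
    show "AE x in lborel. norm (?s' N x) \<le> B * indicator {-R-1..R+1} x" for N
    proof (rule AE_I2)
      fix x
      \<comment> \<open>The sample point lies at most \<open>1\<close> to the left of \<open>x\<close>, whatever the step width.\<close>
      show "norm (?s' N x) \<le> B * indicator {-R-1..R+1} x"
      proof (cases "?s' N x = 0")
        case False
        define y where "y = real_of_int \<lfloor>real (Suc N) * x\<rfloor> / real (Suc N)"
        have y: "real (Suc N) * y = real_of_int \<lfloor>real (Suc N) * x\<rfloor>" by (simp add: y_def)
        have "real (Suc N) * (x - y) \<ge> 0" "real (Suc N) * (x - y) \<le> 1"
          using y by (simp_all only: right_diff_distrib) linarith+
        moreover have "x - y \<le> 1"
        proof (rule ccontr)
          assume "\<not> x - y \<le> 1"
          then have "real (Suc N) * (x - y) > 1 * 1" by (intro mult_le_less_imp_less) auto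
          then show False using calculation by simp
        qed
        moreover have "x - y \<ge> 0" using calculation(1) by (simp add: zero_le_mult_iff)
        moreover have "\<bar>y\<bar> \<le> R" using False R y_def by blast
        ultimately have "x \<in> {-R-1..R+1}" by auto
        then show ?thesis using fB by simp
      qed (use B in \<open>simp add: indicator_def\<close>)
    qed
  qed
  then have "(\<lambda>N. LINT x|lborel. ?s N x) \<longlonglongrightarrow> (LINT x|lborel. f x)"
    by (rule LIMSEQ_imp_Suc)
  moreover have "\<forall>\<^sub>F N in sequentially. (LINT x|lborel. ?s N x) =
      of_real (1 / real N) * (\<Sum>n\<in>F N. f (real_of_int n / real N))"
    using F eventually_gt_at_top[of 0]
    by eventually_elim (rule integral_step_function; blast)
  ultimately show ?thesis by (rule Lim_transform_eventually)
qed

section \<open>Comparison of the two Turan constants\<close>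

text \<open>The supremum is taken over a bounded set, since every competitor has real part at most \<open>1\<close>
  everywhere.\<close>

lemma le_turan_int:
  assumes "finite A" "positive_definite_seq c" "c 0 = 1" "\<And>n. n \<notin> A \<Longrightarrow> c n = 0"
  shows "Re (\<Sum>n\<in>A. c n) \<le> turan_int A"
  unfolding turan_int_def
proof (rule cSup_upper)
  show "bdd_above {Re (\<Sum>n\<in>A. c n) | c :: int \<Rightarrow> complex.
            positive_definite_seq c \<and> c 0 = 1 \<and> (\<forall>n. n \<notin> A \<longrightarrow> c n = 0)}"
  proof (rule bdd_aboveI)
    fix y assume "y \<in> {Re (\<Sum>n\<in>A. c n) | c :: int \<Rightarrow> complex.
            positive_definite_seq c \<and> c 0 = 1 \<and> (\<forall>n. n \<notin> A \<longrightarrow> c n = 0)}"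
    then obtain c where c: "y = (\<Sum>n\<in>A. Re (c n))" "positive_definite_seq c" "c 0 = 1" by auto
    have "(\<Sum>n\<in>A. Re (c n)) \<le> (\<Sum>n\<in>A. 1)"
      using positive_definite_seq_Re_le[OF c(2)] c(3) by (intro sum_mono) simp
    then show "y \<le> real (card A)" using c(1) by simp
  qed
qed (use assms in blast)

text \<open>As in the discrete case the competitors have real part at most \<open>1\<close>. They vanish outside a
  common bounded interval, whose length therefore bounds their integrals.\<close>

lemma le_turan_real:
  assumes "bounded \<Omega>" "continuous_on UNIV f" "positive_definite_fun f" "f 0 = 1"
    "closure {x. f x \<noteq> 0} \<subseteq> \<Omega>"
  shows "Re (LINT x|lborel. f x) \<le> turan_real \<Omega>"
  unfolding turan_real_def
proof (rule cSup_upper)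
  obtain R where R: "\<And>x. x \<in> \<Omega> \<Longrightarrow> \<bar>x\<bar> \<le> R"
    using assms(1) unfolding bounded_iff by auto
  show "bdd_above {Re (LINT x|lborel. f x) | f :: real \<Rightarrow> complex.
            continuous_on UNIV f \<and> positive_definite_fun f \<and> f 0 = 1 \<and>
            closure {x. f x \<noteq> 0} \<subseteq> \<Omega>}"
  proof (rule bdd_aboveI)
    fix y assume "y \<in> {Re (LINT x|lborel. f x) | f :: real \<Rightarrow> complex.
            continuous_on UNIV f \<and> positive_definite_fun f \<and> f 0 = 1 \<and>
            closure {x. f x \<noteq> 0} \<subseteq> \<Omega>}"
    then obtain f :: "real \<Rightarrow> complex" where f: "y = Re (LINT x|lborel. f x)"
      "continuous_on UNIV f" "positive_definite_fun f" "f 0 = 1" "closure {x. f x \<noteq> 0} \<subseteq> \<Omega>"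
      by blast
    have supp: "x \<in> {-R..R}" if "f x \<noteq> 0" for x
    proof -
      have "x \<in> \<Omega>" using that f(5) closure_subset[of "{x. f x \<noteq> 0}"] by auto
      then show ?thesis using R[of x] by (auto simp: abs_le_iff)
    qed
    have "integrable lborel (\<lambda>x. indicator {-R..R} x *\<^sub>R f x)"
      using f(2) by (intro borel_integrable_compact) (auto intro: continuous_on_subset)
    moreover have "(\<lambda>x. indicator {-R..R} x *\<^sub>R f x) = f"
      using supp by (auto simp: fun_eq_iff indicator_def)
    ultimately have int: "integrable lborel f" by simp
    have "y = (LINT x|lborel. Re (f x))" using f(1) int by simp
    also have "\<dots> \<le> (LINT x|lborel. indicator {-R..R} x)"
    proof (rule integral_mono)
      show "Re (f x) \<le> indicator {-R..R} x" for x
        using positive_definite_fun_Re_le[OF f(3), of x] f(4) supp[of x]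
        by (cases "f x = 0") (auto simp: indicator_def)
    qed (use int in \<open>auto intro!: integrable_real_indicator emeasure_bounded_finite\<close>)
    finally show "y \<le> (LINT x|lborel. indicator {-R..R} x)" .
  qed
qed (use assms in blast)

lemma mem_discretization_iff:
  "n \<in> discretization \<Omega> N \<longleftrightarrow> ball (real_of_int n / real N) (1 / real N) \<subseteq> \<Omega>"
proof -
  have "(\<lambda>t. real_of_int n / real N + t) ` {- (1 / real N) <..< 1 / real N} =
      ball (real_of_int n / real N) (1 / real N)"
    using ball_translation[of "real_of_int n / real N" 0 "1 / real N"]
    by (simp add: ball_eq_greaterThanLessThan)
  then show ?thesis by (simp add: discretization_def)
qed

lemma finite_discretization:
  assumes "bounded \<Omega>" "N > 0"
  shows "finite (discretization \<Omega> N)"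
proof -
  obtain R where R: "\<And>x. x \<in> \<Omega> \<Longrightarrow> \<bar>x\<bar> \<le> R"
    using assms(1) unfolding bounded_iff by auto
  have "discretization \<Omega> N \<subseteq> {- \<lceil>R * real N\<rceil>..\<lceil>R * real N\<rceil>}"
  proof
    fix n assume "n \<in> discretization \<Omega> N"
    then have "real_of_int n / real N \<in> \<Omega>"
      using assms(2) by (auto simp: mem_discretization_iff)
    then have "\<bar>real_of_int n\<bar> \<le> R * real N"
      using R[of "real_of_int n / real N"] assms(2) by (simp add: field_simps)
    then show "n \<in> {- \<lceil>R * real N\<rceil>..\<lceil>R * real N\<rceil>}"
      by (simp add: abs_le_iff; linarith)
  qed
  then show ?thesis by (rule finite_subset) simp
qed

text \<open>A compact subset of \<open>\<Omega>\<close> has a uniform neighbourhood inside \<open>\<Omega>\<close>, and \<open>1/N\<close> is eventually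
  smaller than its radius.\<close>

lemma eventually_mem_discretization:
  assumes "compact K" "open \<Omega>" "K \<subseteq> \<Omega>"
  shows "\<forall>\<^sub>F N in sequentially. \<forall>n. real_of_int n / real N \<in> K \<longrightarrow> n \<in> discretization \<Omega> N"
proof -
  obtain e where e: "e > 0" "(\<Union>x\<in>K. ball x e) \<subseteq> \<Omega>"
    using compact_subset_open_imp_ball_epsilon_subset[OF assms] by blast
  have "\<forall>\<^sub>F N in sequentially. 1 / real N < e"
    using order_tendstoD(2)[OF lim_1_over_n e(1)] by simp
  then show ?thesis
  proof eventually_elim
    case (elim N)
    show ?case
    proof (intro allI impI)
      fix n assume "real_of_int n / real N \<in> K"
      then have "ball (real_of_int n / real N) e \<subseteq> \<Omega>" using e(2) by blast
      then show "n \<in> discretization \<Omega> N"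
        using elim unfolding mem_discretization_iff
        by (meson order.trans less_imp_le subset_ball)
    qed
  qed
qed

text \<open>Extend a discrete competitor by hats of half-width \<open>\<theta>/N\<close> with \<open>\<theta> < 1\<close>. This loses a factor
  \<open>\<theta>\<close> in the integral, which disappears as \<open>\<theta>\<close> tends to \<open>1\<close>.\<close>

lemma turan_int_discretization_le:
  assumes "bounded \<Omega>" "N > 0" "0 \<in> discretization \<Omega> N"
  shows "1 / real N * turan_int (discretization \<Omega> N) \<le> turan_real \<Omega>"
proof -
  define A where "A = discretization \<Omega> N"
  have A: "finite A" "0 \<in> A"
    using finite_discretization[OF assms(1,2)] assms(3) by (auto simp: A_def)
  have scaled: "\<theta> * (1 / real N * Re (\<Sum>n\<in>A. c n)) \<le> turan_real \<Omega>"
    if c: "positive_definite_seq c" "c 0 = 1" "\<And>n. n \<notin> A \<Longrightarrow> c n = 0"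
      and \<theta>: "0 < \<theta>" "\<theta> < 1" for c \<theta>
  proof -
    define \<delta> where "\<delta> = \<theta> / real N"
    have \<delta>: "0 < \<delta>" "\<delta> < 1 / real N"
      using \<theta> assms(2) by (auto simp: \<delta>_def field_simps)
    let ?f = "hat_extension (1 / real N) \<delta> A c"
    have "closure {x. ?f x \<noteq> 0} \<subseteq>
        (\<Union>n\<in>A. {real_of_int n * (1 / real N) - \<delta>..real_of_int n * (1 / real N) + \<delta>})"
      by (rule closure_support_hat_extension[OF A(1) \<delta>(1)])
    also have "\<dots> \<subseteq> (\<Union>n\<in>A. ball (real_of_int n / real N) (1 / real N))"
      using \<delta> by (intro UN_mono) (auto simp: dist_real_def)
    also have "\<dots> \<subseteq> \<Omega>"
      unfolding A_def using mem_discretization_iff by blast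
    finally have "Re (LINT x|lborel. ?f x) \<le> turan_real \<Omega>"
      using A \<delta> c assms(1)
      by (intro le_turan_real continuous_hat_extension positive_definite_hat_extension)
        (auto simp: hat_extension_at_0)
    then show ?thesis
      unfolding integral_hat_extension[OF \<delta>(1)] by (simp add: \<delta>_def)
  qed
  have "turan_int A \<le> real N * turan_real \<Omega>"
    unfolding turan_int_def
  proof (rule cSup_least)
    show "{Re (\<Sum>n\<in>A. c n) | c :: int \<Rightarrow> complex.
            positive_definite_seq c \<and> c 0 = 1 \<and> (\<forall>n. n \<notin> A \<longrightarrow> c n = 0)} \<noteq> {}"
      using positive_definite_seq_delta A(2)
      by (auto intro!: exI[of _ "\<lambda>n. if n = 0 then 1 else 0"] split: if_splits)
  next
    fix y assume "y \<in> {Re (\<Sum>n\<in>A. c n) | c :: int \<Rightarrow> complex.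
            positive_definite_seq c \<and> c 0 = 1 \<and> (\<forall>n. n \<notin> A \<longrightarrow> c n = 0)}"
    then obtain c where c: "y = Re (\<Sum>n\<in>A. c n)" "positive_definite_seq c" "c 0 = 1"
      "\<And>n. n \<notin> A \<Longrightarrow> c n = 0" by blast
    have "1 / real N * y \<le> turan_real \<Omega>"
      using scaled[OF c(2-4)] unfolding c(1) by (rule field_le_mult_one_interval)
    then show "y \<le> real N * turan_real \<Omega>"
      using assms(2) by (simp add: field_simps)
  qed
  then show ?thesis using assms(2) by (simp add: A_def field_simps)
qed

text \<open>The samples of \<open>f\<close> at the points \<open>n/N\<close> are a discrete competitor as soon as \<open>N\<close> is large,
  and their normalised sums converge to the integral of \<open>f\<close>.\<close>

lemma eventually_less_turan_int_discretization:
  assumes "open \<Omega>" "bounded \<Omega>" "continuous_on UNIV f" "positive_definite_fun f" "f 0 = 1"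
    "closure {x. f x \<noteq> 0} \<subseteq> \<Omega>" "y < Re (LINT x|lborel. f x)"
  shows "\<forall>\<^sub>F N in sequentially. y < 1 / real N * turan_int (discretization \<Omega> N)"
proof -
  obtain R where R: "\<And>x. x \<in> \<Omega> \<Longrightarrow> \<bar>x\<bar> \<le> R"
    using assms(2) unfolding bounded_iff by auto
  let ?K = "closure {x. f x \<noteq> 0}"
  have K: "x \<in> ?K" if "f x \<noteq> 0" for x
    using that closure_subset[of "{x. f x \<noteq> 0}"] by auto
  have "compact ?K"
    using bounded_subset[OF assms(2,6)] by (simp add: compact_eq_bounded_closed)
  then have mem: "\<forall>\<^sub>F N in sequentially. 0 < N \<and> finite (discretization \<Omega> N) \<and>
      (\<forall>n. f (real_of_int n / real N) \<noteq> 0 \<longrightarrow> n \<in> discretization \<Omega> N)"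
    using eventually_mem_discretization[OF _ assms(1,6)] eventually_gt_at_top[of 0]
    by (auto elim!: eventually_elim2 simp: K finite_discretization[OF assms(2)])
  have "(\<lambda>N. of_real (1 / real N) * (\<Sum>n\<in>discretization \<Omega> N. f (real_of_int n / real N)))
      \<longlonglongrightarrow> (LINT x|lborel. f x)"
    using mem R K assms(6) by (intro riemann_sum_tendsto assms(3)) (auto elim: eventually_mono)
  then have "\<forall>\<^sub>F N in sequentially. y < Re (of_real (1 / real N) *
      (\<Sum>n\<in>discretization \<Omega> N. f (real_of_int n / real N)))"
    by (intro order_tendstoD(1)[OF _ assms(7)] tendsto_Re)
  with mem show ?thesis
  proof eventually_elim
    case (elim N)
    have "Re (\<Sum>n\<in>discretization \<Omega> N. f (real_of_int n / real N)) \<le> turan_int (discretization \<Omega> N)"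
      using elim(1) assms(5) positive_definite_fun_imp_seq[OF assms(4), of "1 / real N"]
      by (intro le_turan_int) auto
    then have "1 / real N * Re (\<Sum>n\<in>discretization \<Omega> N. f (real_of_int n / real N))
        \<le> 1 / real N * turan_int (discretization \<Omega> N)"
      by (intro mult_left_mono) auto
    then show ?case using elim(2) by simp
  qed
qed

lemma turan_int_discretization_tendsto:
  assumes "open \<Omega>" "bounded \<Omega>" "0 \<in> \<Omega>"
  shows "(\<lambda>N. 1 / real N * turan_int (discretization \<Omega> N)) \<longlonglongrightarrow> turan_real \<Omega>"
proof (rule order_tendstoI)
  have le: "\<forall>\<^sub>F N in sequentially. 1 / real N * turan_int (discretization \<Omega> N) \<le> turan_real \<Omega>"
    using eventually_mem_discretization[of "{0}" \<Omega>, simplified, OF assms(1,3)]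
      eventually_gt_at_top[of 0]
  proof eventually_elim
    case (elim N)
    then show ?case using assms(2) by (intro turan_int_discretization_le) auto
  qed
  show "\<forall>\<^sub>F N in sequentially. 1 / real N * turan_int (discretization \<Omega> N) < y"
    if "turan_real \<Omega> < y" for y
    using le by eventually_elim (use that in linarith)
  fix y assume y: "y < turan_real \<Omega>"
  let ?S = "{Re (LINT x|lborel. f x) | f :: real \<Rightarrow> complex.
            continuous_on UNIV f \<and> positive_definite_fun f \<and> f 0 = 1 \<and>
            closure {x. f x \<noteq> 0} \<subseteq> \<Omega>}"
  obtain e where e: "e > 0" "cball 0 e \<subseteq> \<Omega>"
    using assms(1,3) open_contains_cball by blast
  \<comment> \<open>A supremum over the empty set would be an arbitrary real number, so a competitor on the line
    has to be exhibited: a single narrow hat at \<open>0\<close>.\<close>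
  let ?g = "hat_extension 1 (min e 1) {0} (\<lambda>n. if n = 0 then 1 else 0)"
  have "closure {x. ?g x \<noteq> 0} \<subseteq> {- min e 1..min e 1}"
    using closure_support_hat_extension[of "{0}" "min e 1" 1 "\<lambda>n. if n = 0 then 1 else 0"] e(1)
    by simp
  also have "\<dots> \<subseteq> cball 0 e" by (simp add: cball_eq_atLeastAtMost)
  also note e(2)
  finally have "Re (LINT x|lborel. ?g x) \<in> ?S"
    using e(1) positive_definite_seq_delta
    by (auto intro!: exI[of _ ?g] continuous_hat_extension positive_definite_hat_extension
        simp: hat_extension_at_0 split: if_splits)
  then have "?S \<noteq> {}" by blast
  then obtain s where "s \<in> ?S" "y < s"
    using less_cSupE[OF y[unfolded turan_real_def]] by blast
  then show "\<forall>\<^sub>F N in sequentially. y < 1 / real N * turan_int (discretization \<Omega> N)"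
    using assms(1,2) eventually_less_turan_int_discretization by blast
qed

theorem theorem2p8:
  fixes \<Omega> :: "real set" and I :: "(real \<times> real) set"
  assumes "finite I"
    and "\<Omega> = (\<Union>(a, b)\<in>I. {a<..<b})"
    and "uminus ` \<Omega> = \<Omega>"
    and "0 \<in> interior \<Omega>"
  shows "(\<lambda>N. 1 / real N * turan_int (discretization \<Omega> N)) \<longlonglongrightarrow> turan_real \<Omega>"
proof (rule turan_int_discretization_tendsto)
  show "open \<Omega>" unfolding assms(2) by (intro open_UN ballI) auto
  show "bounded \<Omega>" unfolding assms(2) using assms(1) by (intro bounded_UN) auto
  show "0 \<in> \<Omega>" using assms(4) interior_subset by blast
qed

end
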